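(* Let $A$ be a set of $n$ actions, let $f:2^A\to\mathbb{R}_{\ge0}$ be a monotone weakly well-layered (WWL) reward function (accessed via value queries) and let $c:2^A\to\mathbb{R}_{\ge0}$ be a symmetric monotone cost function (i.e., $c(S)$ depends only on $|S|$). Then the optimal contract problem, i.e. finding $\alpha\in[0,1]$ maximizing $u_p(\alpha)=(1-\alpha)f(S_\alpha)$, can be solved in time polynomial in $n$.
   Context: $A$ is a finite set of $n$ actions. A reward function $f$ and a cost function $c$ are monotone set functions with $f(\emptyset)=c(\emptyset)=0$ (in the model $f$ takes values in $[0,1]$). A contract is a number $\alpha\in[0,1]$. The agent's utility is $u_a(\alpha,S)=\alpha f(S)-c(S)$. Let $D_{f,c}(\alpha)=\operatorname{argmax}_{S\subseteq A}u_a(\alpha,S)$ and $D^*_{f,c}(\alpha)=\operatorname{argmax}_{S\in D_{f,c}(\alpha)}f(S)$. Any $S_\alpha\in D^*_{f,c}(\alpha)$ is an agent's best response; $f(S_\alpha)$ does not depend on the choice. The principal's utility is $u_p(\alpha)=(1-\alpha)f(S_\alpha)$. Weakly well-layered (WWL): for every sequence $S_0=\emptyset$, $S_i=S_{i-1}\cup\{x_i\}$ with $x_i\in\operatorname{argmax}_{x\notin S_{i-1}}\{f(S_{i-1}\cup\{x\})-f(S_{i-1})\}$ (ties broken arbitrarily), one has $S_i\in\operatorname{argmax}_{|S|=i}f(S)$ for every $i\in[n]$. A value query returns $f(S)$ for a given $S\subseteq A$. Polynomial time means that the number of value queries and elementary arithmetic operations/comparisons on reals is bounded by a polynomial in $n$.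 *)

theory Defs
  imports Complex_Main "HOL-Library.FuncSet" "HOL-Computational_Algebra.Polynomial"
begin

section \<open>Contracts\<close>

definition agent_utility :: "('a set \<Rightarrow> real) \<Rightarrow> ('a set \<Rightarrow> real) \<Rightarrow> real \<Rightarrow> 'a set \<Rightarrow> real" where
  "agent_utility f c \<alpha> S = \<alpha> * f S - c S"

definition demand :: "'a set \<Rightarrow> ('a set \<Rightarrow> real) \<Rightarrow> ('a set \<Rightarrow> real) \<Rightarrow> real \<Rightarrow> 'a set set" where
  "demand A f c \<alpha> = {S. is_arg_max (agent_utility f c \<alpha>) (\<lambda>S. S \<subseteq> A) S}"

definition best_responses ::
  "'a set \<Rightarrow> ('a set \<Rightarrow> real) \<Rightarrow> ('a set \<Rightarrow> real) \<Rightarrow> real \<Rightarrow> 'a set set" where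
  "best_responses A f c \<alpha> = {S. is_arg_max f (\<lambda>S. S \<in> demand A f c \<alpha>) S}"

text \<open>For finite \<open>A\<close> the value does not depend on the choice; see the two lemmas below.\<close>

definition principal_utility ::
  "'a set \<Rightarrow> ('a set \<Rightarrow> real) \<Rightarrow> ('a set \<Rightarrow> real) \<Rightarrow> real \<Rightarrow> real" where
  "principal_utility A f c \<alpha> = (1 - \<alpha>) * f (SOME S. S \<in> best_responses A f c \<alpha>)"

lemma best_responses_nonempty:
  assumes "finite A"
  shows "best_responses A f c \<alpha> \<noteq> {}"
proof -
  have arg_max_ex: "\<exists>x. is_arg_max g (\<lambda>x. x \<in> X) x"
    if "finite X" "X \<noteq> {}" for g :: "'a set \<Rightarrow> real" and X
  proof -
    have "Max (g ` X) \<in> g ` X"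
      using that by (intro Max_in) auto
    then obtain x where "x \<in> X" "g x = Max (g ` X)"
      by force
    with that show ?thesis
      by (intro exI[of _ x]) (auto simp: is_arg_max_linorder)
  qed
  have "demand A f c \<alpha> \<noteq> {}"
    using arg_max_ex[of "Pow A" "agent_utility f c \<alpha>"] assms by (auto simp: demand_def)
  moreover have "finite (demand A f c \<alpha>)"
    by (rule finite_subset[of _ "Pow A"]) (use assms in \<open>auto simp: demand_def is_arg_max_def\<close>)
  ultimately show ?thesis
    using arg_max_ex[of "demand A f c \<alpha>" f] by (auto simp: best_responses_def)
qed

lemma best_responses_same_reward:
  "S \<in> best_responses A f c \<alpha> \<Longrightarrow> T \<in> best_responses A f c \<alpha> \<Longrightarrow> f S = f T"
  by (auto simp: best_responses_def is_arg_max_linorder intro!: antisym)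

definition optimal_contract ::
  "'a set \<Rightarrow> ('a set \<Rightarrow> real) \<Rightarrow> ('a set \<Rightarrow> real) \<Rightarrow> real \<Rightarrow> bool" where
  "optimal_contract A f c \<alpha> \<longleftrightarrow> is_arg_max (principal_utility A f c) (\<lambda>\<alpha>. \<alpha> \<in> {0..1}) \<alpha>"

definition greedy_sequence ::
  "'a set \<Rightarrow> ('a set \<Rightarrow> real) \<Rightarrow> (nat \<Rightarrow> 'a) \<Rightarrow> (nat \<Rightarrow> 'a set) \<Rightarrow> bool" where
  "greedy_sequence A f x S \<longleftrightarrow> S 0 = {} \<and>
     (\<forall>i\<in>{1..card A}.
        is_arg_max (\<lambda>y. f (S (i - 1) \<union> {y}) - f (S (i - 1))) (\<lambda>y. y \<in> A - S (i - 1)) (x i) \<and>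
        S i = S (i - 1) \<union> {x i})"

definition weakly_well_layered :: "'a set \<Rightarrow> ('a set \<Rightarrow> real) \<Rightarrow> bool" where
  "weakly_well_layered A f \<longleftrightarrow>
     (\<forall>x S. greedy_sequence A f x S \<longrightarrow>
        (\<forall>i\<in>{1..card A}. is_arg_max f (\<lambda>T. T \<subseteq> A \<and> card T = i) (S i)))"

definition symmetric_on :: "'a set \<Rightarrow> ('a set \<Rightarrow> real) \<Rightarrow> bool" where
  "symmetric_on A c \<longleftrightarrow> (\<forall>S\<in>Pow A. \<forall>T\<in>Pow A. card S = card T \<longrightarrow> c S = c T)"

section \<open>Real-number machine with value queries\<close>

text \<open>
  A uniform model: one program text serves all inputs. The memory holds natural-number variables
  (for loop counters and indices), arrays of exact reals, and the set of action indices currently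
  submitted to the oracles. Real numbers enter the control flow only through comparisons, and there
  is no conversion from reals to naturals. Every instruction performs a single operation and costs
  one time unit, as does the evaluation of a branching condition; in particular the running time
  bounds the number of queries, arithmetic operations and comparisons. Programs contain no real
  constants other than natural numbers.
\<close>

type_synonym vname = string

datatype operand = Lit nat | Var vname

text \<open>A real memory cell is given by an array name and an index.\<close>

type_synonym cell = "vname \<times> operand"

datatype arith = Plus | Minus | Times | Divide

datatype instr =
    NAdd vname operand operand
  | NSub vname operand operand
  | ROfNat cell operand
  | RCopy cell cell
  | ROp cell arith cell cell
  | SetClear
  | SetInsert operand
  | SetRemove operand
  | QueryReward cell
  | QueryCost cell

datatype cond =
    NLess operand operand
  | RLess cell cell
  | SetMember operand

datatype prog =
    Skip
  | Do instr
  | Seq prog prog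
  | Cond cond prog prog
  | While cond prog

record state =
  nats :: "vname \<Rightarrow> nat"
  reals :: "vname \<Rightarrow> nat \<Rightarrow> real"
  query_set :: "nat set"

fun operand_val :: "state \<Rightarrow> operand \<Rightarrow> nat" where
  "operand_val s (Lit k) = k"
| "operand_val s (Var v) = nats s v"

definition cell_val :: "state \<Rightarrow> cell \<Rightarrow> real" where
  "cell_val s = (\<lambda>(a, i). reals s a (operand_val s i))"

definition write_nat :: "vname \<Rightarrow> nat \<Rightarrow> state \<Rightarrow> state" where
  "write_nat v k s = s\<lparr>nats := (nats s)(v := k)\<rparr>"

definition write_cell :: "cell \<Rightarrow> real \<Rightarrow> state \<Rightarrow> state" where
  "write_cell = (\<lambda>(a, i) r s.
     s\<lparr>reals := (reals s)(a := (reals s a)(operand_val s i := r))\<rparr>)"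

text \<open>Division by zero yields zero, which a program could equally obtain by a preceding test.\<close>

fun arith_val :: "arith \<Rightarrow> real \<Rightarrow> real \<Rightarrow> real" where
  "arith_val Plus x y = x + y"
| "arith_val Minus x y = x - y"
| "arith_val Times x y = x * y"
| "arith_val Divide x y = x / y"

text \<open>The oracles \<open>F\<close> (reward) and \<open>C\<close> (cost) receive sets of action indices.\<close>

fun exec_instr :: "(nat set \<Rightarrow> real) \<Rightarrow> (nat set \<Rightarrow> real) \<Rightarrow> instr \<Rightarrow> state \<Rightarrow> state" where
  "exec_instr F C (NAdd v i j) s = write_nat v (operand_val s i + operand_val s j) s"
| "exec_instr F C (NSub v i j) s = write_nat v (operand_val s i - operand_val s j) s"
| "exec_instr F C (ROfNat a i) s = write_cell a (real (operand_val s i)) s"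
| "exec_instr F C (RCopy a b) s = write_cell a (cell_val s b) s"
| "exec_instr F C (ROp a opr b d) s = write_cell a (arith_val opr (cell_val s b) (cell_val s d)) s"
| "exec_instr F C SetClear s = s\<lparr>query_set := {}\<rparr>"
| "exec_instr F C (SetInsert i) s = s\<lparr>query_set := insert (operand_val s i) (query_set s)\<rparr>"
| "exec_instr F C (SetRemove i) s = s\<lparr>query_set := query_set s - {operand_val s i}\<rparr>"
| "exec_instr F C (QueryReward a) s = write_cell a (F (query_set s)) s"
| "exec_instr F C (QueryCost a) s = write_cell a (C (query_set s)) s"

fun cond_val :: "state \<Rightarrow> cond \<Rightarrow> bool" where
  "cond_val s (NLess i j) \<longleftrightarrow> operand_val s i < operand_val s j"
| "cond_val s (RLess a b) \<longleftrightarrow> cell_val s a < cell_val s b"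
| "cond_val s (SetMember i) \<longleftrightarrow> operand_val s i \<in> query_set s"

text \<open>\<open>runs F C P s t s'\<close>: started in \<open>s\<close>, program \<open>P\<close> halts in \<open>s'\<close> after \<open>t\<close> time units.\<close>

inductive runs ::
  "(nat set \<Rightarrow> real) \<Rightarrow> (nat set \<Rightarrow> real) \<Rightarrow> prog \<Rightarrow> state \<Rightarrow> nat \<Rightarrow> state \<Rightarrow> bool"
  for F C where
  Skip: "runs F C Skip s 0 s"
| Do: "runs F C (Do a) s 1 (exec_instr F C a s)"
| Seq: "runs F C P s t s' \<Longrightarrow> runs F C Q s' t' s'' \<Longrightarrow> runs F C (Seq P Q) s (t + t') s''"
| CondTrue: "cond_val s b \<Longrightarrow> runs F C P s t s' \<Longrightarrow> runs F C (Cond b P Q) s (Suc t) s'"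
| CondFalse: "\<not> cond_val s b \<Longrightarrow> runs F C Q s t s' \<Longrightarrow> runs F C (Cond b P Q) s (Suc t) s'"
| WhileFalse: "\<not> cond_val s b \<Longrightarrow> runs F C (While b P) s 1 s"
| WhileTrue: "cond_val s b \<Longrightarrow> runs F C P s t s' \<Longrightarrow> runs F C (While b P) s' t' s'' \<Longrightarrow>
    runs F C (While b P) s (Suc (t + t')) s''"

inductive_cases SkipE: "runs F C Skip s t s'"
inductive_cases DoE: "runs F C (Do a) s t s'"
inductive_cases SeqE: "runs F C (Seq P Q) s t s'"
inductive_cases CondE: "runs F C (Cond b P Q) s t s'"
inductive_cases WhileE: "runs F C (While b P) s t s'"

lemma runs_deterministic:
  "runs F C P s t s' \<Longrightarrow> runs F C P s u r \<Longrightarrow> u = t \<and> r = s'"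
proof (induction arbitrary: u r rule: runs.induct)
  case Skip then show ?case by (auto elim: SkipE)
next
  case Do then show ?case by (auto elim: DoE)
next
  case Seq then show ?case by (blast elim: SeqE)
next
  case CondTrue then show ?case by (blast elim: CondE)
next
  case CondFalse then show ?case by (blast elim: CondE)
next
  case (WhileFalse s b P)
  from WhileFalse.prems show ?case
    by (rule WhileE) (use WhileFalse in auto)
next
  case (WhileTrue s b P t s' t' s'')
  from WhileTrue.prems show ?case
    by (rule WhileE) (use WhileTrue in blast)+
qed

text \<open>The program is given the number of actions; everything else must be queried.\<close>

definition initial_state :: "nat \<Rightarrow> state" where
  "initial_state n = \<lparr>nats = (\<lambda>_. 0)(''n'' := n), reals = (\<lambda>_ _. 0), query_set = {}\<rparr>"

definition result :: "state \<Rightarrow> real" where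
  "result s = reals s ''out'' 0"

text \<open>
  The machine addresses actions by their positions in an enumeration \<open>e\<close> of \<open>A\<close>;
  indices outside \<open>{..<n}\<close> denote no action and are ignored.
\<close>

definition value_oracle :: "nat \<Rightarrow> (nat \<Rightarrow> 'a) \<Rightarrow> ('a set \<Rightarrow> real) \<Rightarrow> nat set \<Rightarrow> real" where
  "value_oracle n e g I = g (e ` (I \<inter> {..<n}))"

end

theory Submission
  imports Defs
begin

text \<open>
  Greedy selection yields sets \<open>S\<^sub>0 \<subseteq> \<dots> \<subseteq> S\<^sub>n\<close> of maximal reward in each size; write \<open>v\<^sub>i\<close> and \<open>c\<^sub>i\<close>
  for their rewards and costs. Let \<open>L\<^sub>j\<close> be the maximum of \<open>0\<close> and the ratios
  \<open>(c\<^sub>j - c\<^sub>i) / (v\<^sub>j - v\<^sub>i)\<close> with \<open>i < j\<close>. A best response of size \<open>j\<close> to a contract \<open>\<alpha>\<close> forces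
  \<open>L\<^sub>j \<le> \<alpha>\<close>, so \<open>u\<^sub>p \<alpha> \<le> (1 - L\<^sub>j) * v\<^sub>j\<close>. Conversely, at \<open>L\<^sub>j\<close> the agent weakly prefers \<open>S\<^sub>j\<close> to every
  set of smaller reward, so that \<open>u\<^sub>p L\<^sub>j \<ge> (1 - L\<^sub>j) * v\<^sub>j\<close> even if \<open>S\<^sub>j\<close> itself is not in demand.
  Hence it suffices to maximise \<open>(1 - L\<^sub>j) * v\<^sub>j\<close> over \<open>j\<close>.
\<close>

section \<open>Incentive thresholds\<close>

text \<open>Division by zero is harmless: it contributes the ratio \<open>0\<close>, which is in the set anyway.\<close>

definition threshold_upto :: "(nat \<Rightarrow> real) \<Rightarrow> (nat \<Rightarrow> real) \<Rightarrow> nat \<Rightarrow> nat \<Rightarrow> real" where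
  "threshold_upto v c j k = Max (insert 0 ((\<lambda>i. (c j - c i) / (v j - v i)) ` {..<k}))"

abbreviation threshold :: "(nat \<Rightarrow> real) \<Rightarrow> (nat \<Rightarrow> real) \<Rightarrow> nat \<Rightarrow> real" where
  "threshold v c j \<equiv> threshold_upto v c j j"

abbreviation threshold_value :: "(nat \<Rightarrow> real) \<Rightarrow> (nat \<Rightarrow> real) \<Rightarrow> nat \<Rightarrow> real" where
  "threshold_value v c j \<equiv> (1 - threshold v c j) * v j"

lemma threshold_upto_0 [simp]: "threshold_upto v c j 0 = 0"
  by (simp add: threshold_upto_def)

text \<open>One comparison per further index: this is the recurrence that the inner loop of the
  threshold phase executes, and the reason why \<open>k\<close> is separate from
  \<open>j\<close>.\<close>

lemma threshold_upto_Suc: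
  "threshold_upto v c j (Suc k) = max (threshold_upto v c j k) ((c j - c k) / (v j - v k))"
  unfolding threshold_upto_def lessThan_Suc image_insert
  by (subst insert_commute, subst Max_insert) (auto simp: max.commute)

lemma threshold_upto_nonneg: "0 \<le> threshold_upto v c j k"
  by (simp add: threshold_upto_def)

lemma ratio_le_threshold: "i < j \<Longrightarrow> (c j - c i) / (v j - v i) \<le> threshold v c j"
  by (simp add: threshold_upto_def)

lemma threshold_le:
  assumes "0 \<le> b" "\<And>i. i < j \<Longrightarrow> (c j - c i) / (v j - v i) \<le> b"
  shows "threshold v c j \<le> b"
  using assms by (simp add: threshold_upto_def)

text \<open>The contract argument, isolated from the machine. \<open>v\<close> and \<open>w\<close>
  stand for the recorded arrays, so they are tied to the sets \<open>S i\<close> only up to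
  \<open>card A\<close>. What remains of the greedy choice is maximality within each size and
  monotone \<open>v\<close>.\<close>

lemma best_threshold_optimal:
  assumes fin: "finite A"
    and sub: "\<And>i. i \<le> card A \<Longrightarrow> S i \<subseteq> A"
    and crd: "\<And>i. i \<le> card A \<Longrightarrow> card (S i) = i"
    and best: "\<And>T. T \<subseteq> A \<Longrightarrow> f T \<le> f (S (card T))"
    and cost: "symmetric_on A c"
    and v: "\<And>i. i \<le> card A \<Longrightarrow> v i = f (S i)"
    and w: "\<And>i. i \<le> card A \<Longrightarrow> w i = c (S i)"
    and mono: "\<And>i j. i \<le> j \<Longrightarrow> j \<le> card A \<Longrightarrow> v i \<le> v j"
    and v0: "v 0 = 0"
    and m: "m \<le> card A"
    and max: "\<And>j. j \<le> card A \<Longrightarrow> threshold_value v w j \<le> threshold_value v w m"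
  shows "optimal_contract A f c (threshold v w m)"
proof -
  have cle: "card T \<le> card A" if "T \<subseteq> A" for T
    using that fin by (simp add: card_mono)
  have cT: "c T = w (card T)" if "T \<subseteq> A" for T
    using cost that sub[OF cle[OF that]] crd[OF cle[OF that]] w[OF cle[OF that]]
    unfolding symmetric_on_def by (metis Pow_iff)
  have fT: "f T \<le> v (card T)" if "T \<subseteq> A" for T
    using best[OF that] v cle[OF that] by simp
  \<comment> \<open>The third fact is the tie-breaking: a set that the agent likes as much as
    \<open>R\<close> is itself in demand, so its reward cannot exceed that of
    \<open>R\<close>.\<close>
  have br: "R \<subseteq> A"
      "\<And>T. T \<subseteq> A \<Longrightarrow> \<alpha> * f T - c T \<le> \<alpha> * f R - c R"
      "\<And>T. T \<subseteq> A \<Longrightarrow> \<alpha> * f R - c R \<le> \<alpha> * f T - c T \<Longrightarrow> f T \<le> f R"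
    if "R \<in> best_responses A f c \<alpha>" for R \<alpha>
  proof -
    have demand: "T \<in> demand A f c \<alpha> \<longleftrightarrow> T \<subseteq> A \<and> (\<forall>T'\<subseteq>A. \<alpha> * f T' - c T' \<le> \<alpha> * f T - c T)" for T
      by (auto simp: demand_def is_arg_max_linorder agent_utility_def)
    have R: "R \<in> demand A f c \<alpha>" "\<And>T. T \<in> demand A f c \<alpha> \<Longrightarrow> f T \<le> f R"
      using that by (simp_all add: best_responses_def is_arg_max_linorder)
    show "R \<subseteq> A" "\<And>T. T \<subseteq> A \<Longrightarrow> \<alpha> * f T - c T \<le> \<alpha> * f R - c R"
      using R(1) unfolding demand by blast+
    then show "\<And>T. T \<subseteq> A \<Longrightarrow> \<alpha> * f R - c R \<le> \<alpha> * f T - c T \<Longrightarrow> f T \<le> f R"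
      using R(2) unfolding demand by (meson order_trans)
  qed
  define R where "R \<alpha> = (SOME S. S \<in> best_responses A f c \<alpha>)" for \<alpha>
  have R: "R \<alpha> \<in> best_responses A f c \<alpha>" for \<alpha>
    unfolding R_def using best_responses_nonempty[OF fin, of f c \<alpha>] by (simp add: some_in_eq)
  have u: "principal_utility A f c \<alpha> = (1 - \<alpha>) * f (R \<alpha>)" for \<alpha>
    by (simp add: principal_utility_def R_def)

  have upper: "principal_utility A f c \<alpha> \<le> threshold_value v w m" if \<alpha>: "0 \<le> \<alpha>" "\<alpha> \<le> 1" for \<alpha>
  proof -
    let ?j = "card (R \<alpha>)"
    note R = br[OF R[of \<alpha>]]
    have j: "?j \<le> card A" using R(1) by (rule cle)
    have "threshold v w ?j \<le> \<alpha>"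
    proof (rule threshold_le)
      fix i assume i: "i < ?j"
      have "\<alpha> * v i - w i \<le> \<alpha> * f (R \<alpha>) - w ?j"
        using R(2)[of "S i"] i j sub[of i] v[of i] w[of i] cT[OF R(1)] by simp
      \<comment> \<open>The greedy set of the same size costs the same and earns at least as much,
        so \<open>f (R \<alpha>)\<close> may be replaced by \<open>v ?j\<close>.\<close>
      also have "\<dots> \<le> \<alpha> * v ?j - w ?j"
        using fT[OF R(1)] \<alpha>(1) by (simp add: mult_left_mono)
      finally have le: "w ?j - w i \<le> \<alpha> * (v ?j - v i)"
        by (simp add: algebra_simps)
      show "(w ?j - w i) / (v ?j - v i) \<le> \<alpha>"
      proof (cases "v ?j = v i")
        case False
        then have "v i < v ?j" using mono[of i ?j] i j by simp
        with le show ?thesis by (simp add: pos_divide_le_eq)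
      qed (use \<alpha> in simp)
    qed (fact \<alpha>)
    moreover have "0 \<le> v ?j" using mono[of 0 ?j] v0 j by simp
    moreover have "(1 - \<alpha>) * f (R \<alpha>) \<le> (1 - \<alpha>) * v ?j"
      using fT[OF R(1)] \<alpha>(2) by (simp add: mult_left_mono)
    ultimately have "(1 - \<alpha>) * f (R \<alpha>) \<le> threshold_value v w ?j"
      by (meson diff_left_mono mult_right_mono order_trans)
    then show ?thesis using max[OF j] u by simp
  qed

  let ?L = "threshold v w m"
  have L0: "0 \<le> ?L" by (rule threshold_upto_nonneg)
  \<comment> \<open>Size 0 has value 0, so the maximal value is nonnegative, which for
    \<open>v m > 0\<close> forces \<open>?L \<le> 1\<close>. If \<open>v m = 0\<close>, all smaller
    sizes have reward 0 too and every ratio is 0 by the division convention.\<close>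
  have L1: "?L \<le> 1"
  proof (cases "v m = 0")
    case True
    have "?L \<le> 0"
    proof (rule threshold_le)
      fix i assume "i < m"
      then have "v i = v m"
        using mono[of 0 i] mono[of i m] v0 m True by simp
      then show "(w m - w i) / (v m - v i) \<le> 0" by simp
    qed simp
    then show ?thesis by simp
  next
    case False
    then have "0 < v m" using mono[of 0 m] v0 m by simp
    moreover have "0 \<le> threshold_value v w m" using max[of 0] v0 by simp
    ultimately show ?thesis by (simp add: zero_le_mult_iff)
  qed

  \<comment> \<open>Suppose the response, of size \<open>?k\<close>, earned less than
    \<open>v m\<close>. Its reward is \<open>v ?k\<close>, since \<open>S ?k\<close> costs the same
    and tie-breaking applies. Monotonicity gives \<open>?k < m\<close>, so the ratio of
    \<open>m\<close> and \<open>?k\<close> is at most \<open>?L\<close>. Hence the agent likes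
    \<open>S m\<close> at least as much, and tie-breaking yields a contradiction.\<close>
  have "v m \<le> f (R ?L)"
  proof (rule ccontr)
    note R = br[OF R[of ?L]]
    let ?k = "card (R ?L)"
    assume less: "\<not> v m \<le> f (R ?L)"
    have k: "?k \<le> card A" using R(1) by (rule cle)
    have "?L * f (R ?L) - c (R ?L) \<le> ?L * f (S ?k) - c (S ?k)"
      using best[OF R(1)] cT[OF R(1)] w[OF k] L0 by (simp add: mult_left_mono)
    then have "f (S ?k) \<le> f (R ?L)" using R(3) sub[OF k] by blast
    then have fR: "f (R ?L) = v ?k" using best[OF R(1)] v[OF k] by simp
    with less mono[of m ?k] k have "?k < m" by fastforce
    then have "(w m - w ?k) / (v m - v ?k) \<le> ?L" by (rule ratio_le_threshold)
    then have "w m - w ?k \<le> ?L * (v m - v ?k)"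
      using less fR by (simp add: pos_divide_le_eq)
    then have "?L * f (R ?L) - c (R ?L) \<le> ?L * f (S m) - c (S m)"
      using fR cT[OF R(1)] v[OF m] w[OF m] by (simp add: algebra_simps)
    then have "f (S m) \<le> f (R ?L)" using R(3) sub[OF m] by blast
    then show False using less v[OF m] by simp
  qed
  then have lower: "threshold_value v w m \<le> principal_utility A f c ?L"
    unfolding u using L1 by (simp add: mult_left_mono)
  show ?thesis
    using order_trans[OF upper lower] L0 L1 by (simp add: optimal_contract_def is_arg_max_linorder)
qed

section \<open>Reasoning about programs\<close>

text \<open>Total correctness with an upper bound on time instead of an exact cost, so that the
  branches of a conditional can share one bound.\<close>

definition halts_within ::
  "(nat set \<Rightarrow> real) \<Rightarrow> (nat set \<Rightarrow> real) \<Rightarrow> prog \<Rightarrow> nat \<Rightarrow> state \<Rightarrow> (state \<Rightarrow> bool) \<Rightarrow> bool" where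
  "halts_within F C P T s Q \<longleftrightarrow> (\<exists>t s'. runs F C P s t s' \<and> t \<le> T \<and> Q s')"

lemma halts_within_Seq:
  assumes "halts_within F C P T s R" "\<And>s'. R s' \<Longrightarrow> halts_within F C P' T' s' Q"
  shows "halts_within F C (Seq P P') (T + T') s Q"
  using assms unfolding halts_within_def by (meson add_mono runs.Seq)

lemma halts_within_weaken:
  assumes "halts_within F C P T s Q" "T \<le> T'" "\<And>s'. Q s' \<Longrightarrow> Q' s'"
  shows "halts_within F C P T' s Q'"
  using assms unfolding halts_within_def by (meson order_trans)

text \<open>Every loop here counts up to a limit fixed in advance, so the invariant is indexed by
  the number of completed rounds. Each round pays one unit for its test, and the final 1 is the
  failing test.\<close>

lemma halts_within_While:
  assumes start: "I 0 s"
    and step: "\<And>i s. i < m \<Longrightarrow> I i s \<Longrightarrow> cond_val s b \<and> halts_within F C P T s (I (Suc i))"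
    and stop: "\<And>s. I m s \<Longrightarrow> \<not> cond_val s b"
  shows "halts_within F C (While b P) (m * Suc T + 1) s (I m)"
proof -
  have "halts_within F C (While b P) ((m - i) * Suc T + 1) s (I m)" if "i \<le> m" "I i s" for i s
    using that
  proof (induction i arbitrary: s rule: inc_induct)
    case base
    then show ?case using stop[of s] unfolding halts_within_def
      by (intro exI[of _ 1] exI[of _ s] conjI runs.WhileFalse) auto
  next
    case (step i)
    from assms(2)[OF step.hyps(2) step.prems] obtain t s'
      where 1: "cond_val s b" "runs F C P s t s'" "t \<le> T" "I (Suc i) s'"
      unfolding halts_within_def by blast
    from step.IH[OF 1(4)] obtain t' s''
      where 2: "runs F C (While b P) s' t' s''" "t' \<le> (m - Suc i) * Suc T + 1" "I m s''"
      unfolding halts_within_def by blast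
    have "m - i = Suc (m - Suc i)" using step.hyps by simp
    then have "Suc (t + t') \<le> (m - i) * Suc T + 1" using 1(3) 2(2) by simp
    with runs.WhileTrue[OF 1(1,2) 2(1)] 2(3) show ?case
      unfolding halts_within_def by blast
  qed
  from this[of 0, OF _ start] show ?thesis by simp
qed

fun loop_free :: "prog \<Rightarrow> bool" where
  "loop_free (Seq P Q) \<longleftrightarrow> loop_free P \<and> loop_free Q"
| "loop_free (Cond b P Q) \<longleftrightarrow> loop_free P \<and> loop_free Q"
| "loop_free (While b P) \<longleftrightarrow> False"
| "loop_free _ \<longleftrightarrow> True"

fun step_bound :: "prog \<Rightarrow> nat" where
  "step_bound (Do a) = 1"
| "step_bound (Seq P Q) = step_bound P + step_bound Q"
| "step_bound (Cond b P Q) = Suc (max (step_bound P) (step_bound Q))"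
| "step_bound _ = 0"

fun exec :: "(nat set \<Rightarrow> real) \<Rightarrow> (nat set \<Rightarrow> real) \<Rightarrow> prog \<Rightarrow> state \<Rightarrow> state" where
  "exec F C (Do a) s = exec_instr F C a s"
| "exec F C (Seq P Q) s = exec F C Q (exec F C P s)"
| "exec F C (Cond b P Q) s = (if cond_val s b then exec F C P s else exec F C Q s)"
| "exec F C _ s = s"

text \<open>Code without loops can thus be executed symbolically by rewriting with
  \<open>exec\<close>; only loops call for invariants. The values of \<open>exec\<close> and
  \<open>step_bound\<close> at \<open>While\<close> are dummies.\<close>

lemma loop_free_runs:
  assumes "loop_free P"
  shows "\<exists>t\<le>step_bound P. runs F C P s t (exec F C P s)"
  using assms
proof (induction P arbitrary: s)
  case Skip
  then show ?case by (auto intro: runs.Skip)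
next
  case (Do a)
  then show ?case using runs.Do[of F C a s] by auto
next
  case (Seq P Q)
  then show ?case by simp (meson add_mono runs.Seq)
next
  case (Cond b P Q)
  then obtain t u where "t \<le> step_bound P" "runs F C P s t (exec F C P s)"
      "u \<le> step_bound Q" "runs F C Q s u (exec F C Q s)"
    by fastforce
  then show ?case
    by (intro exI[of _ "if cond_val s b then Suc t else Suc u"]) (auto intro: runs.CondTrue runs.CondFalse)
qed simp

lemma halts_within_loop_free:
  assumes "loop_free P" "step_bound P = T" "Q (exec F C P s)"
  shows "halts_within F C P T s Q"
  using loop_free_runs[OF assms(1), of F C s] assms(2,3) unfolding halts_within_def by blast

section \<open>The greedy phase\<close>

text \<open>
  The query set holds the current greedy set; arrays \<open>v\<close> and \<open>c\<close> record reward and cost of the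
  greedy set of each size. No initial candidate is needed: the cell \<open>v[j]\<close> starts at \<open>0\<close>, rewards are
  nonnegative, and ties replace the current candidate.
\<close>

definition pick_step :: prog where
  "pick_step =
     Seq (Cond (SetMember (Var ''i''))
            Skip
            (Seq (Do (SetInsert (Var ''i'')))
            (Seq (Do (QueryReward (''q'', Lit 0)))
            (Seq (Do (SetRemove (Var ''i'')))
                 (Cond (RLess (''q'', Lit 0) (''v'', Var ''j''))
                    Skip
                    (Seq (Do (RCopy (''v'', Var ''j'') (''q'', Lit 0)))
                         (Do (NAdd ''b'' (Var ''i'') (Lit 0)))))))))
         (Do (NAdd ''i'' (Var ''i'') (Lit 1)))"

definition greedy_step :: prog where
  "greedy_step =
     Seq (Seq (Do (NAdd ''j'' (Var ''j'') (Lit 1))) (Do (NAdd ''i'' (Lit 0) (Lit 0))))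
    (Seq (While (NLess (Var ''i'') (Var ''n'')) pick_step)
         (Seq (Do (SetInsert (Var ''b''))) (Do (QueryCost (''c'', Var ''j'')))))"

definition greedy_prog :: prog where
  "greedy_prog = While (NLess (Var ''j'') (Var ''n'')) greedy_step"

text \<open>\<open>x i\<close> is the choice of round \<open>i\<close>, counted from 0. Total
  rewards are compared instead of marginal gains; the two differ by a constant within a
  round.\<close>

definition greedy_prefix :: "nat \<Rightarrow> (nat set \<Rightarrow> real) \<Rightarrow> (nat \<Rightarrow> nat) \<Rightarrow> nat \<Rightarrow> bool" where
  "greedy_prefix n F x j \<longleftrightarrow> (\<forall>i<j. x i \<in> {..<n} - x ` {..<i} \<and>
     (\<forall>y\<in>{..<n} - x ` {..<i}. F (insert y (x ` {..<i})) \<le> F (insert (x i) (x ` {..<i}))))"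

text \<open>The cells \<open>best\<close> and \<open>out\<close> belong to the threshold phase,
  which relies on finding them at 0.\<close>

definition recorded ::
  "nat \<Rightarrow> (nat set \<Rightarrow> real) \<Rightarrow> (nat set \<Rightarrow> real) \<Rightarrow> (nat \<Rightarrow> nat) \<Rightarrow> nat \<Rightarrow> state \<Rightarrow> bool" where
  "recorded n F C x j s \<longleftrightarrow> nats s ''n'' = n \<and> query_set s = x ` {..<j} \<and>
     (\<forall>i\<le>j. reals s ''v'' i = F (x ` {..<i}) \<and> reals s ''c'' i = C (x ` {..<i})) \<and>
     reals s ''best'' 0 = 0 \<and> reals s ''out'' 0 = 0"

text \<open>Knowledge after scanning the indices below \<open>k\<close>: \<open>r\<close> is the
  best reward seen and \<open>b\<close> attains it. Until a candidate outside \<open>J\<close>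
  appears, \<open>r\<close> is the default 0 and \<open>b\<close> is arbitrary.\<close>

definition picked :: "(nat set \<Rightarrow> real) \<Rightarrow> nat set \<Rightarrow> nat \<Rightarrow> nat \<Rightarrow> real \<Rightarrow> bool" where
  "picked F J k b r \<longleftrightarrow> (\<forall>y\<in>{..<k} - J. F (insert y J) \<le> r) \<and>
     (if {..<k} - J = {} then r = 0 else b \<in> {..<k} - J \<and> r = F (insert b J))"

lemma picked_skip: "picked F J k b r \<Longrightarrow> k \<in> J \<Longrightarrow> picked F J (Suc k) b r"
  unfolding picked_def lessThan_Suc by (auto simp: insert_Diff_if split: if_splits)

text \<open>Had no candidate been seen, \<open>r\<close> would be 0 and the strict inequality would
  contradict nonnegativity; so a witness \<open>b\<close> exists and stays.\<close>

lemma picked_keep: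
  assumes "picked F J k b r" "F (insert k J) < r" "0 \<le> F (insert k J)"
  shows "picked F J (Suc k) b r"
  using assms unfolding picked_def lessThan_Suc
  by (auto simp: insert_Diff_if less_le split: if_splits)

lemma picked_replace:
  assumes "picked F J k b r" "r \<le> F (insert k J)" "k \<notin> J"
  shows "picked F J (Suc k) k (F (insert k J))"
proof -
  have "\<forall>z\<in>{..<Suc k} - J. F (insert z J) \<le> F (insert k J)"
    using assms(1) unfolding picked_def by (auto simp: less_Suc_eq intro: order_trans[OF _ assms(2)])
  moreover have "k \<in> {..<Suc k} - J" using assms(3) by simp
  ultimately show ?thesis unfolding picked_def by auto
qed

text \<open>The cell is \<open>Suc j\<close> because the size counter advances before the scan. The
  zero cells beyond it supply the default for later rounds.\<close>

definition pick_inv ::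
  "nat \<Rightarrow> (nat set \<Rightarrow> real) \<Rightarrow> (nat set \<Rightarrow> real) \<Rightarrow> (nat \<Rightarrow> nat) \<Rightarrow> nat \<Rightarrow> nat \<Rightarrow> state \<Rightarrow> bool" where
  "pick_inv n F C x j k s \<longleftrightarrow> recorded n F C x j s \<and>
     nats s ''j'' = Suc j \<and> nats s ''i'' = k \<and> (\<forall>i>Suc j. reals s ''v'' i = 0) \<and>
     picked F (x ` {..<j}) k (nats s ''b'') (reals s ''v'' (Suc j))"

lemma pick_step_inv:
  assumes F: "\<And>I. 0 \<le> F I" and inv: "pick_inv n F C x j k s"
  shows "pick_inv n F C x j (Suc k) (exec F C pick_step s)"
proof -
  let ?J = "x ` {..<j}"
  have p: "picked F ?J k (nats s ''b'') (reals s ''v'' (Suc j))"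
    using inv by (simp add: pick_inv_def)
  consider "k \<in> ?J" | "k \<notin> ?J" "F (insert k ?J) < reals s ''v'' (Suc j)"
    | "k \<notin> ?J" "\<not> F (insert k ?J) < reals s ''v'' (Suc j)"
    by blast
  then show ?thesis
  proof cases
    case 1
    then show ?thesis using inv picked_skip[OF p 1]
      by (simp add: pick_inv_def recorded_def pick_step_def write_nat_def)
  next
    case 2
    then show ?thesis using inv picked_keep[OF p 2(2) F]
      by (simp add: pick_inv_def recorded_def pick_step_def write_nat_def write_cell_def cell_val_def)
  next
    case 3
    then show ?thesis using inv picked_replace[OF p _ 3(1)]
      by (simp add: pick_inv_def recorded_def pick_step_def write_nat_def write_cell_def cell_val_def)
  qed
qed

definition greedy_inv ::
  "nat \<Rightarrow> (nat set \<Rightarrow> real) \<Rightarrow> (nat set \<Rightarrow> real) \<Rightarrow> nat \<Rightarrow> state \<Rightarrow> bool" where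
  "greedy_inv n F C j s \<longleftrightarrow> nats s ''j'' = j \<and> (\<forall>i>j. reals s ''v'' i = 0) \<and>
     (\<exists>x. greedy_prefix n F x j \<and> recorded n F C x j s)"

lemma greedy_step_inv:
  assumes F: "\<And>I. 0 \<le> F I" and j: "j < n" and inv: "greedy_inv n F C j s"
  shows "halts_within F C greedy_step (9 * n + 5) s (greedy_inv n F C (Suc j))"
proof -
  from inv obtain x where x: "greedy_prefix n F x j" "recorded n F C x j s"
    and s: "nats s ''j'' = j" "\<And>i. i > j \<Longrightarrow> reals s ''v'' i = 0"
    unfolding greedy_inv_def by blast
  let ?J = "x ` {..<j}"
  \<comment> \<open>Fewer than \<open>n\<close> actions are chosen so far, so the completed scan has
    met a candidate and \<open>b\<close> is a genuine choice.\<close>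
  have "card ?J < card {..<n}"
    using j card_image_le[of "{..<j}" x] by simp
  then have ne: "{..<n} - ?J \<noteq> {}"
    by (metis Diff_eq_empty_iff card_mono finite_imageI finite_lessThan not_le)
  let ?init = "Seq (Do (NAdd ''j'' (Var ''j'') (Lit 1))) (Do (NAdd ''i'' (Lit 0) (Lit 0)))"
  let ?fin = "Seq (Do (SetInsert (Var ''b''))) (Do (QueryCost (''c'', Var ''j'')))"
  have init: "halts_within F C ?init 2 s (pick_inv n F C x j 0)"
    using x(2) s
    by (intro halts_within_loop_free) (simp_all add: pick_inv_def recorded_def write_nat_def picked_def)
  \<comment> \<open>8 is the cost of the longest branch of \<open>pick_step\<close>;
    \<open>Suc 8\<close> adds the loop test.\<close>
  have loop: "halts_within F C (While (NLess (Var ''i'') (Var ''n'')) pick_step) (n * Suc 8 + 1) s'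
      (pick_inv n F C x j n)" if "pick_inv n F C x j 0 s'" for s'
  proof (rule halts_within_While[where I = "pick_inv n F C x j"])
    fix k r assume "k < n" and r: "pick_inv n F C x j k r"
    have "halts_within F C pick_step 8 r (pick_inv n F C x j (Suc k))"
      by (intro halts_within_loop_free pick_step_inv[OF F r]) (simp_all add: pick_step_def)
    with \<open>k < n\<close> r show "cond_val r (NLess (Var ''i'') (Var ''n'')) \<and>
        halts_within F C pick_step 8 r (pick_inv n F C x j (Suc k))"
      by (simp add: pick_inv_def recorded_def)
  qed (use that in \<open>auto simp: pick_inv_def recorded_def\<close>)
  have fin: "halts_within F C ?fin 2 s' (greedy_inv n F C (Suc j))" if p: "pick_inv n F C x j n s'" for s'
  proof -
    let ?b = "nats s' ''b''"
    define y where "y = x(j := ?b)"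
    have y: "y j = ?b" "\<And>i. i < j \<Longrightarrow> y i = x i"
      by (simp_all add: y_def)
    then have img: "y ` {..<i} = x ` {..<i}" if "i \<le> j" for i
      using that by (intro image_cong) auto
    have imgS: "y ` {..<Suc j} = insert ?b ?J"
      using img[of j] y(1) by (simp add: lessThan_Suc)
    have b: "?b \<in> {..<n} - ?J" "reals s' ''v'' (Suc j) = F (insert ?b ?J)"
        "\<And>z. z \<in> {..<n} - ?J \<Longrightarrow> F (insert z ?J) \<le> F (insert ?b ?J)"
      using p ne unfolding pick_inv_def picked_def by metis+
    have "greedy_prefix n F y (Suc j)"
      using x(1) b(1,3) unfolding greedy_prefix_def by (simp add: less_Suc_eq img y all_conj_distrib)
    moreover have "recorded n F C y (Suc j) (exec F C ?fin s')"
      using p imgS b(2) unfolding recorded_def pick_inv_def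
      by (auto simp: le_Suc_eq img write_cell_def)
    moreover have "nats (exec F C ?fin s') ''j'' = Suc j"
        "\<And>i. i > Suc j \<Longrightarrow> reals (exec F C ?fin s') ''v'' i = 0"
      using p by (simp_all add: pick_inv_def write_cell_def)
    ultimately have "greedy_inv n F C (Suc j) (exec F C ?fin s')"
      unfolding greedy_inv_def by blast
    then show ?thesis by (intro halts_within_loop_free) simp_all
  qed
  have "halts_within F C greedy_step (2 + ((n * Suc 8 + 1) + 2)) s (greedy_inv n F C (Suc j))"
    unfolding greedy_step_def using init loop fin by (intro halts_within_Seq)
  then show ?thesis by (rule halts_within_weaken) simp_all
qed

lemma greedy_prog_correct:
  assumes F: "\<And>I. 0 \<le> F I" "F {} = 0" "C {} = 0"
  shows "halts_within F C greedy_prog (n * (9 * n + 6) + 1) (initial_state n) (greedy_inv n F C n)"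
proof -
  have "halts_within F C greedy_prog (n * Suc (9 * n + 5) + 1) (initial_state n) (greedy_inv n F C n)"
    unfolding greedy_prog_def
  proof (rule halts_within_While[where I = "greedy_inv n F C"])
    \<comment> \<open>The zeroed arrays already hold reward and cost of the empty set, so no query
      is made for size 0.\<close>
    show "greedy_inv n F C 0 (initial_state n)"
      using F by (auto simp: greedy_inv_def greedy_prefix_def recorded_def initial_state_def)
    fix j s assume "j < n" and s: "greedy_inv n F C j s"
    then show "cond_val s (NLess (Var ''j'') (Var ''n'')) \<and>
        halts_within F C greedy_step (9 * n + 5) s (greedy_inv n F C (Suc j))"
      using greedy_step_inv[of F j n C s] F(1) by (auto simp: greedy_inv_def recorded_def)
  qed (auto simp: greedy_inv_def recorded_def)
  then show ?thesis by (rule halts_within_weaken) simp_all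
qed

section \<open>The threshold phase\<close>

definition ratio_step :: prog where
  "ratio_step =
     Seq (Do (ROp (''x'', Lit 0) Minus (''c'', Var ''j'') (''c'', Var ''i'')))
    (Seq (Do (ROp (''y'', Lit 0) Minus (''v'', Var ''j'') (''v'', Var ''i'')))
    (Seq (Do (ROp (''x'', Lit 0) Divide (''x'', Lit 0) (''y'', Lit 0)))
    (Seq (Cond (RLess (''L'', Lit 0) (''x'', Lit 0))
            (Do (RCopy (''L'', Lit 0) (''x'', Lit 0)))
            Skip)
         (Do (NAdd ''i'' (Var ''i'') (Lit 1))))))"

definition improve_step :: prog where
  "improve_step =
     Seq (Do (ROfNat (''x'', Lit 0) (Lit 1)))
    (Seq (Do (ROp (''x'', Lit 0) Minus (''x'', Lit 0) (''L'', Lit 0)))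
    (Seq (Do (ROp (''x'', Lit 0) Times (''x'', Lit 0) (''v'', Var ''j'')))
         (Cond (RLess (''best'', Lit 0) (''x'', Lit 0))
            (Seq (Do (RCopy (''best'', Lit 0) (''x'', Lit 0)))
                 (Do (RCopy (''out'', Lit 0) (''L'', Lit 0))))
            Skip)))"

definition threshold_step :: prog where
  "threshold_step =
     Seq (Seq (Do (NAdd ''j'' (Var ''j'') (Lit 1)))
         (Seq (Do (NAdd ''i'' (Lit 0) (Lit 0)))
              (Do (ROfNat (''L'', Lit 0) (Lit 0)))))
    (Seq (While (NLess (Var ''i'') (Var ''j'')) ratio_step)
         improve_step)"

definition threshold_prog :: prog where
  "threshold_prog =
     Seq (Do (NAdd ''j'' (Lit 0) (Lit 0)))
         (While (NLess (Var ''j'') (Var ''n'')) threshold_step)"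

definition threshold_inv :: "nat \<Rightarrow> (nat \<Rightarrow> real) \<Rightarrow> (nat \<Rightarrow> real) \<Rightarrow> nat \<Rightarrow> state \<Rightarrow> bool" where
  "threshold_inv n v c j s \<longleftrightarrow> nats s ''n'' = n \<and> reals s ''v'' = v \<and> reals s ''c'' = c \<and>
     (\<forall>i\<le>j. threshold_value v c i \<le> reals s ''best'' 0) \<and>
     (\<exists>m\<le>j. reals s ''best'' 0 = threshold_value v c m \<and> reals s ''out'' 0 = threshold v c m)"

definition ratio_inv :: "nat \<Rightarrow> (nat \<Rightarrow> real) \<Rightarrow> (nat \<Rightarrow> real) \<Rightarrow> nat \<Rightarrow> nat \<Rightarrow> state \<Rightarrow> bool" where
  "ratio_inv n v c j k s \<longleftrightarrow> threshold_inv n v c j s \<and> nats s ''j'' = Suc j \<and> nats s ''i'' = k \<and>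
     reals s ''L'' 0 = threshold_upto v c (Suc j) k"

lemma threshold_step_inv:
  assumes j: "j < n" and s: "threshold_inv n v c j s" "nats s ''j'' = j"
  shows "halts_within F C threshold_step (7 * n + 10) s
           (\<lambda>s'. threshold_inv n v c (Suc j) s' \<and> nats s' ''j'' = Suc j)"
    (is "halts_within F C _ _ s ?Q")
proof -
  let ?init = "Seq (Do (NAdd ''j'' (Var ''j'') (Lit 1)))
         (Seq (Do (NAdd ''i'' (Lit 0) (Lit 0)))
              (Do (ROfNat (''L'', Lit 0) (Lit 0))))"
  have init: "halts_within F C ?init 3 s (ratio_inv n v c j 0)"
    using s by (intro halts_within_loop_free)
      (simp_all add: ratio_inv_def threshold_inv_def write_nat_def write_cell_def)
  have loop: "halts_within F C (While (NLess (Var ''i'') (Var ''j'')) ratio_step)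
      (Suc j * Suc 6 + 1) s' (ratio_inv n v c j (Suc j))" if "ratio_inv n v c j 0 s'" for s'
  proof (rule halts_within_While[where I = "ratio_inv n v c j"])
    fix k r assume k: "k < Suc j" and r: "ratio_inv n v c j k r"
    have "ratio_inv n v c j (Suc k) (exec F C ratio_step r)"
      using r unfolding ratio_inv_def threshold_inv_def ratio_step_def
      by (simp add: write_nat_def write_cell_def cell_val_def threshold_upto_Suc max_def)
    then have "halts_within F C ratio_step 6 r (ratio_inv n v c j (Suc k))"
      by (intro halts_within_loop_free) (simp_all add: ratio_step_def)
    with k r show "cond_val r (NLess (Var ''i'') (Var ''j'')) \<and>
        halts_within F C ratio_step 6 r (ratio_inv n v c j (Suc k))"
      by (simp add: ratio_inv_def)
  qed (use that in \<open>auto simp: ratio_inv_def\<close>)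
  have fin: "halts_within F C improve_step 6 s' ?Q" if r: "ratio_inv n v c j (Suc j) s'" for s'
  proof -
    have "?Q (exec F C improve_step s')"
    proof (cases "reals s' ''best'' 0 < threshold_value v c (Suc j)")
      case True
      then show ?thesis
        using r unfolding ratio_inv_def threshold_inv_def improve_step_def
        by (auto simp: write_cell_def cell_val_def le_Suc_eq)
    next
      case False
      then show ?thesis
        using r unfolding ratio_inv_def threshold_inv_def improve_step_def
        by (auto simp: write_cell_def cell_val_def le_Suc_eq)
    qed
    then show ?thesis
      by (intro halts_within_loop_free[where Q = ?Q]) (simp_all add: improve_step_def)
  qed
  have "halts_within F C threshold_step (3 + ((Suc j * Suc 6 + 1) + 6)) s ?Q"
    unfolding threshold_step_def using init loop fin by (intro halts_within_Seq)
  \<comment> \<open>The sum is \<open>7 * Suc j + 10\<close>, and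
    \<open>Suc j \<le> n\<close>.\<close>
  then show ?thesis by (rule halts_within_weaken) (use j in simp_all)
qed

lemma threshold_prog_correct:
  assumes "nats s ''n'' = n" "reals s ''v'' = v" "reals s ''c'' = c" "v 0 = 0"
    "reals s ''best'' 0 = 0" "reals s ''out'' 0 = 0"
  shows "halts_within F C threshold_prog (n * (7 * n + 11) + 2) s (threshold_inv n v c n)"
proof -
  let ?I = "\<lambda>j s. threshold_inv n v c j s \<and> nats s ''j'' = j"
  let ?init = "Do (NAdd ''j'' (Lit 0) (Lit 0))"
  \<comment> \<open>Size 0 is handled without a round of the loop: its threshold is 0 and its value
    is 0 because \<open>v 0 = 0\<close>, as the initial \<open>out\<close> and \<open>best\<close>
    say.\<close>
  have init: "halts_within F C ?init 1 s (?I 0)"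
    using assms
    by (intro halts_within_loop_free[where Q = "?I 0"]) (simp_all add: threshold_inv_def write_nat_def)
  have loop: "halts_within F C (While (NLess (Var ''j'') (Var ''n'')) threshold_step)
      (n * Suc (7 * n + 10) + 1) s' (?I n)" if "?I 0 s'" for s'
  proof (rule halts_within_While[where I = ?I])
    fix j r assume "j < n" "?I j r"
    then show "cond_val r (NLess (Var ''j'') (Var ''n'')) \<and>
        halts_within F C threshold_step (7 * n + 10) r (?I (Suc j))"
      using threshold_step_inv[of j n v c r F C] by (simp add: threshold_inv_def)
  qed (use that in \<open>auto simp: threshold_inv_def\<close>)
  have "halts_within F C threshold_prog (1 + (n * Suc (7 * n + 10) + 1)) s (?I n)"
    unfolding threshold_prog_def using init loop by (intro halts_within_Seq)
  then show ?thesis by (rule halts_within_weaken) (simp_all add: algebra_simps)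
qed

section \<open>Correctness of the algorithm\<close>

text \<open>Transfers the choices from indices to actions along the bijection \<open>e\<close>. All
  queried indices lie below \<open>n\<close>, so the oracle drops none of them. The shift
  \<open>i - 1\<close> reconciles rounds counted from 0 with sequences counted from 1.\<close>

lemma greedy_prefix_sequence:
  assumes e: "bij_betw e {..<n} A" and x: "greedy_prefix n (value_oracle n e f) x n"
  shows "greedy_sequence A f (\<lambda>i. e (x (i - 1))) (\<lambda>i. e ` x ` {..<i})"
  unfolding greedy_sequence_def
proof (intro conjI ballI)
  have card: "card A = n" using bij_betw_same_card[OF e] by simp
  have img: "e ` {..<n} = A" and inj: "inj_on e {..<n}"
    using e by (auto simp: bij_betw_def)
  have xn: "x k < n" if "k < n" for k
    using x that unfolding greedy_prefix_def by blast
  fix i assume "i \<in> {1..card A}"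
  then obtain k where i: "i = Suc k" and k: "k < n"
    by (cases i) (auto simp: card)
  let ?I = "x ` {..<k}"
  have I: "?I \<subseteq> {..<n}" using xn k by auto
  have query: "value_oracle n e f (insert y ?I) = f (e ` ?I \<union> {e y})" if "y < n" for y
  proof -
    have "insert y ?I \<inter> {..<n} = insert y ?I" using that I by auto
    then show ?thesis by (simp add: value_oracle_def)
  qed
  have diff: "A - e ` ?I = e ` ({..<n} - ?I)"
    using inj_on_image_set_diff[OF inj, of "{..<n}" ?I] I img by auto
  have xk: "x k \<in> {..<n} - ?I"
      "\<And>y. y \<in> {..<n} - ?I \<Longrightarrow> f (e ` ?I \<union> {e y}) \<le> f (e ` ?I \<union> {e (x k)})"
    using x k xn[OF k] query unfolding greedy_prefix_def by (metis DiffD1 lessThan_iff)+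
  show "is_arg_max (\<lambda>y. f (e ` x ` {..<i - 1} \<union> {y}) - f (e ` x ` {..<i - 1}))
          (\<lambda>y. y \<in> A - e ` x ` {..<i - 1}) (e (x (i - 1)))"
    using xk unfolding is_arg_max_linorder i diff_Suc_1 diff by auto
  show "e ` x ` {..<i} = e ` x ` {..<i - 1} \<union> {e (x (i - 1))}"
    by (simp add: i lessThan_Suc)
qed simp

lemma algorithm_correct:
  fixes A :: "'a set" and e :: "nat \<Rightarrow> 'a"
  assumes A: "finite A" "card A = n" and e: "bij_betw e {..<n} A"
    and f: "f \<in> Pow A \<rightarrow> {0..}" "f {} = 0" "mono_on (Pow A) f" "weakly_well_layered A f"
    and c: "c {} = 0" "symmetric_on A c"
  shows "halts_within (value_oracle n e f) (value_oracle n e c) (Seq greedy_prog threshold_prog)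
           ((n * (9 * n + 6) + 1) + (n * (7 * n + 11) + 2)) (initial_state n)
           (\<lambda>s. optimal_contract A f c (result s))"
proof (rule halts_within_Seq)
  let ?F = "value_oracle n e f" and ?C = "value_oracle n e c"
  have img: "e ` {..<n} = A" using e by (simp add: bij_betw_def)
  have "0 \<le> ?F I" for I
  proof -
    have "e ` (I \<inter> {..<n}) \<in> Pow A" using img by auto
    with f(1) show ?thesis by (auto simp: value_oracle_def Pi_iff)
  qed
  then show "halts_within ?F ?C greedy_prog (n * (9 * n + 6) + 1) (initial_state n)
      (greedy_inv n ?F ?C n)"
    using f(2) c(1) by (intro greedy_prog_correct) (auto simp: value_oracle_def)
  fix s assume "greedy_inv n ?F ?C n s"
  then obtain x where x: "greedy_prefix n ?F x n" and s: "recorded n ?F ?C x n s"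
    unfolding greedy_inv_def by blast
  let ?S = "\<lambda>i. e ` x ` {..<i}"
  let ?v = "reals s ''v''" and ?w = "reals s ''c''"
  have xn: "x k < n" if "k < n" for k
    using x that unfolding greedy_prefix_def by blast
  have S: "?S i \<subseteq> A" if "i \<le> n" for i
    using img xn that by force
  \<comment> \<open>The machine resolves ties in favour of the largest index. Weak well-layeredness
    covers every way of breaking ties, hence also this one.\<close>
  have layer: "is_arg_max f (\<lambda>T. T \<subseteq> A \<and> card T = i) (?S i)" if "i \<in> {1..n}" for i
    using f(4) greedy_prefix_sequence[OF e x] that A(2) unfolding weakly_well_layered_def by blast
  \<comment> \<open>A maximiser of layer \<open>i\<close> has size \<open>i\<close> by definition;
    only the empty set at size 0 is separate.\<close>
  have crd: "card (?S i) = i" if "i \<le> n" for i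
    using layer[of i] that by (cases "i = 0") (auto simp: is_arg_max_def)
  have best: "f T \<le> f (?S (card T))" if "T \<subseteq> A" for T
  proof (cases "card T = 0")
    case True
    then have "T = {}" using that A(1) finite_subset by fastforce
    then show ?thesis by simp
  next
    case False
    then show ?thesis
      using layer[of "card T"] that card_mono[OF A(1) that] A(2) by (auto simp: is_arg_max_linorder)
  qed
  have inter: "x ` {..<i} \<inter> {..<n} = x ` {..<i}" if "i \<le> n" for i
    using xn that by force
  have v: "?v i = f (?S i)" and w: "?w i = c (?S i)" if "i \<le> n" for i
    using s that inter[OF that] by (simp_all add: recorded_def value_oracle_def)
  have v0: "?v 0 = 0" using v[of 0] f(2) by simp
  have mono: "?v i \<le> ?v j" if "i \<le> j" "j \<le> n" for i j
    unfolding v[OF that(2)] v[OF le_trans[OF that]]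
    using that S by (intro mono_onD[OF f(3)]) (auto intro!: image_mono)
  have opt: "optimal_contract A f c (threshold ?v ?w m)"
    if "m \<le> n" "\<And>j. j \<le> n \<Longrightarrow> threshold_value ?v ?w j \<le> threshold_value ?v ?w m" for m
    using that S crd best v w mono v0 c(2) A
    by (intro best_threshold_optimal[where S = ?S]) auto
  have run: "halts_within ?F ?C threshold_prog (n * (7 * n + 11) + 2) s (threshold_inv n ?v ?w n)"
    using s v0 by (intro threshold_prog_correct) (auto simp: recorded_def)
  have "optimal_contract A f c (result s')" if "threshold_inv n ?v ?w n s'" for s'
    using that opt unfolding threshold_inv_def result_def by metis
  with run show "halts_within ?F ?C threshold_prog (n * (7 * n + 11) + 2) s
      (\<lambda>s. optimal_contract A f c (result s))"
    by (rule halts_within_weaken[OF _ order_refl])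
qed

theorem propositionA2:
  "\<exists>(P :: prog) (p :: nat poly).
     \<forall>(A :: 'a set) (n :: nat) (e :: nat \<Rightarrow> 'a) (f :: 'a set \<Rightarrow> real) (c :: 'a set \<Rightarrow> real).
       finite A \<and> card A = n \<and> bij_betw e {..<n} A \<and>
       f \<in> Pow A \<rightarrow> {0..} \<and> f {} = 0 \<and> mono_on (Pow A) f \<and> weakly_well_layered A f \<and>
       c \<in> Pow A \<rightarrow> {0..} \<and> c {} = 0 \<and> mono_on (Pow A) c \<and> symmetric_on A c \<longrightarrow>
       (\<exists>t s. runs (value_oracle n e f) (value_oracle n e c) P (initial_state n) t s \<and>
              t \<le> poly p n \<and> optimal_contract A f c (result s))"
\<comment> \<open>The polynomial, with coefficients in ascending order, is the sum of the bounds
  \<open>n * (9 * n + 6) + 1\<close> and \<open>n * (7 * n + 11) + 2\<close> of the two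
  phases.\<close>
proof (intro exI[of _ "Seq greedy_prog threshold_prog"] exI[of _ "[:3, 17, 16:] :: nat poly"]
    allI impI, elim conjE)
  fix A :: "'a set" and n e f c
  assume "finite A" "card A = n" "bij_betw e {..<n} A"
    "f \<in> Pow A \<rightarrow> {0..}" "f {} = 0" "mono_on (Pow A) f" "weakly_well_layered A f"
    "c {} = 0" "symmetric_on A c"
  from halts_within_weaken[OF algorithm_correct[OF this], of "poly [:3, 17, 16:] n"]
  show "\<exists>t s. runs (value_oracle n e f) (value_oracle n e c) (Seq greedy_prog threshold_prog)
          (initial_state n) t s \<and> t \<le> poly [:3, 17, 16:] n \<and> optimal_contract A f c (result s)"
    unfolding halts_within_def by (simp add: algebra_simps numeral_eq_Suc)
qed

end
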